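(* Let $\ell\ge 5$ be a prime, let $k>1$ and $s\geq 1$ be integers with $s\le\lfloor k/2\rfloor$, and let $b$ be a positive integer with $\gcd(\ell,b)=1$. Then for all integers $n\ge 0$ and all integers $r$ with $0\le r<\ell$ and $r\ne\lfloor \ell/24\rfloor$, $$p_{-(\ell^{k}-b)/b}\left(\ell^{2s} n+\ell^{2s-1} r+\frac{(\ell-24\lfloor \ell/24\rfloor)\,\ell^{2s-1}-1}{24}\right)\equiv 0 \pmod{\ell^{k-2s+1}}.$$
   Context: For a rational number $t\neq 0$, the rational numbers $p_t(n)$, $n\ge 0$, are defined by the formal power series identity $\sum_{n\ge 0}p_t(n)q^n=\prod_{j\ge 1}(1-q^j)^t$, where each factor $(1-q^j)^t$ is the binomial series with constant term $1$. For a prime $\ell$ not dividing the denominator of $t$, a congruence $p_t(N)\equiv 0\pmod{\ell^k}$ means that the numerator of $p_t(N)$, written as a reduced fraction, is divisible by $\ell^k$ (the denominator of $p_t(N)$ is then coprime to $\ell$). *)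

theory Defs
  imports "HOL-Analysis.Analysis" "HOL-Number_Theory.Number_Theory"
begin

text \<open>The binomial series for \<open>(1 - q^j)^t\<close>; substitution is only meaningful for \<open>j \<ge> 1\<close>.\<close>

definition euler_factor :: "rat \<Rightarrow> nat \<Rightarrow> rat fps" where
  "euler_factor t j = fps_binomial t oo (- (fps_X ^ j))"

text \<open>
  The infinite product is taken in the metric of formal power series (coefficientwise
  stabilisation); its factors are indexed by \<open>Suc j\<close>, that is, by the integers \<open>\<ge> 1\<close>.
  Convergence is \<open>euler_power_has_prod\<close> below.
\<close>

definition euler_power :: "rat \<Rightarrow> rat fps" where
  "euler_power t = prodinf (\<lambda>j. euler_factor t (Suc j))"

definition frac_partition :: "rat \<Rightarrow> nat \<Rightarrow> rat" where
  "frac_partition t n = fps_nth (euler_power t) n"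

lemma euler_factor_nth_0: "fps_nth (euler_factor t j) 0 = 1"
  by (simp add: euler_factor_def)

lemma euler_factor_nth_less:
  assumes "0 < m" "m < j"
  shows "fps_nth (euler_factor t j) m = 0"
proof -
  have "fps_nth ((- (fps_X ^ j) :: rat fps) ^ i) m = 0" if "i \<le> m" for i
  proof (cases "i = 0")
    case True
    then show ?thesis using assms by simp
  next
    case False
    have "(- (fps_X ^ j) :: rat fps) ^ i = fps_const ((-1) ^ i) * fps_X ^ (j * i)"
      by (subst power_minus) (simp add: power_mult fps_const_power [symmetric] fps_const_neg [symmetric])
    moreover have "m < j * i"
      using False assms by (metis less_le_trans mult.right_neutral mult_le_mono2 Suc_leI One_nat_def neq0_conv)
    ultimately show ?thesis
      by (simp only: fps_mult_left_const_nth fps_X_power_nth) simp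
  qed
  then show ?thesis
    by (simp add: euler_factor_def fps_compose_nth)
qed

lemma euler_power_has_prod: "(\<lambda>j. euler_factor t (Suc j)) has_prod euler_power t"
proof -
  define P where "P = (\<lambda>N. \<Prod>j\<le>N. euler_factor t (Suc j))"
  define G where "G = Abs_fps (\<lambda>n. fps_nth (P n) n)"
  have stab: "fps_nth (P N) n = fps_nth (P n) n" if "n \<le> N" for n N
    using that
  proof (induction N rule: dec_induct)
    case (step N)
    have "fps_nth (P (Suc N)) n =
        (\<Sum>i=0..n. fps_nth (P N) i * fps_nth (euler_factor t (Suc (Suc N))) (n - i))"
      by (simp add: P_def fps_mult_nth)
    also have "\<dots> = (\<Sum>i=0..n. if i = n then fps_nth (P N) n else 0)"
    proof (intro sum.cong refl)
      fix i assume "i \<in> {0..n}"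
      then show "fps_nth (P N) i * fps_nth (euler_factor t (Suc (Suc N))) (n - i) =
          (if i = n then fps_nth (P N) n else 0)"
        using step by (auto simp: euler_factor_nth_0 euler_factor_nth_less)
    qed
    also have "\<dots> = fps_nth (P N) n" by simp
    finally show ?case using step by simp
  qed simp
  have "P \<longlonglongrightarrow> G"
    unfolding tendsto_fps_iff
    by (auto simp: G_def eventually_sequentially intro: stab)
  moreover have "fps_nth G 0 = 1"
    by (simp add: G_def P_def euler_factor_nth_0)
  then have "G \<noteq> 0" by auto
  ultimately have "(\<lambda>j. euler_factor t (Suc j)) has_prod G"
    by (simp add: has_prod_def raw_has_prod_def P_def)
  then show ?thesis
    using has_prod_unique by (metis euler_power_def)
qed

text \<open>The natural-number subtraction and division in the progression are exact.\<close>

lemma progression_offset_exact: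
  fixes l s :: nat
  assumes "prime l" "l \<ge> 5" "s \<ge> 1"
  shows "24 * (((l - 24 * (l div 24)) * l ^ (2 * s - 1) - 1) div 24) + 1
           = (l - 24 * (l div 24)) * l ^ (2 * s - 1)"
proof -
  have "\<not> 2 dvd l" "\<not> 3 dvd l"
    using assms primes_dvd_imp_eq[of 2 l] primes_dvd_imp_eq[of 3 l] by auto
  then have "l mod 24 mod 2 \<noteq> 0" "l mod 24 mod 3 \<noteq> 0"
    by presburger+
  moreover have "x * x mod 24 = 1" if "x < 24" "x mod 2 \<noteq> 0" "x mod 3 \<noteq> 0" for x :: nat
  proof -
    have "\<forall>x\<in>set [0..<24]. (x::nat) mod 2 \<noteq> 0 \<longrightarrow> x mod 3 \<noteq> 0 \<longrightarrow> x * x mod 24 = 1"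
      by code_simp
    moreover have "x \<in> set [0..<24]"
      using that(1) by (simp only: set_upt atLeastLessThan_iff le0 simp_thms)
    ultimately show ?thesis
      using that(2,3) by blast
  qed
  moreover have "l mod 24 < 24"
    by (rule mod_less_divisor) simp
  ultimately have "(l mod 24) * (l mod 24) mod 24 = 1"
    by blast
  then have sq: "[l ^ 2 = 1] (mod 24)"
    by (simp add: cong_def power2_eq_square mod_mult_eq)
  have "[(l - 24 * (l div 24)) * l ^ (2 * s - 1) = l * l ^ (2 * s - 1)] (mod 24)"
    by (intro cong_mult cong_refl) (simp add: cong_def minus_mult_div_eq_mod)
  also have "l * l ^ (2 * s - 1) = (l ^ 2) ^ s"
    using assms(3) by (simp only: power_mult [symmetric] power_Suc [symmetric]) simp
  also have "[(l ^ 2) ^ s = 1] (mod 24)"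
    using cong_pow[OF sq, of s] by simp
  finally have "((l - 24 * (l div 24)) * l ^ (2 * s - 1)) mod 24 = 1"
    by (simp add: cong_def)
  moreover have "24 * ((x - 1) div 24) + 1 = x" if "x mod 24 = 1" for x :: nat
  proof -
    have "x = 24 * (x div 24) + 1"
      using mult_div_mod_eq[of 24 x] that by simp
    then obtain q where "x = 24 * q + 1" by blast
    then show ?thesis by simp
  qed
  ultimately show ?thesis by blast
qed

end

theory Submission
  imports Defs
begin

text \<open>
  With \<open>t = 1 - l^k/b\<close> the product splits as Euler's product times \<open>G = (\<Prod>(1 - q^j))^u\<close>,
  \<open>u = -l^k/b\<close>. The logarithmic derivative of \<open>G\<close> is \<open>u\<close> times an integral series, so
  \<open>m\<close> times the coefficient of \<open>q^m\<close> in \<open>G\<close> is divisible by \<open>l^k\<close>: modulo \<open>l^(k-2s+1)\<close> only the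
  exponents divisible by \<open>l^(2s)\<close> survive. Euler's product is supported on those \<open>i\<close> for which
  \<open>24 i + 1\<close> is a square, and for \<open>N\<close> in the progression \<open>24 N + 1\<close> has \<open>l\<close>-adic valuation
  exactly \<open>2s - 1\<close>, which is odd, so it is not congruent to a square modulo \<open>l^(2s)\<close>.
\<close>

section \<open>Rationals with denominator prime to \<open>l\<close>\<close>

text \<open>For prime \<open>l\<close> this is the localization of the integers at \<open>l\<close>,
  kept inside \<open>rat\<close> so that a congruence modulo l^e becomes membership of x / l^e. The
  fraction need not be reduced, which makes closure under sums and products immediate.\<close>

definition localized_ints :: "nat \<Rightarrow> rat set" where
  "localized_ints l = {of_int a / of_int d | a d. coprime d (int l)}"

definition localized_fps :: "nat \<Rightarrow> rat fps set" where
  "localized_fps l = {f. \<forall>n. fps_nth f n \<in> localized_ints l}"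

context
  fixes l :: nat
  assumes prime_l: "prime l"
begin

lemma localized_ints_I: "coprime d (int l) \<Longrightarrow> of_int a / of_int d \<in> localized_ints l"
  by (auto simp: localized_ints_def)

lemma localized_ints_E:
  assumes "x \<in> localized_ints l"
  obtains a d where "coprime d (int l)" "d \<noteq> 0" "x = of_int a / of_int d"
proof -
  obtain a d where *: "coprime d (int l)" "x = of_int a / of_int d"
    using assms by (auto simp: localized_ints_def)
  moreover have "d \<noteq> 0"
    using *(1) prime_l by auto
  ultimately show thesis using that by blast
qed

lemma localized_ints_of_int [simp]: "of_int a \<in> localized_ints l"
  using localized_ints_I[of 1 a] by simp

lemma localized_ints_0 [simp]: "0 \<in> localized_ints l"
  using localized_ints_of_int[of 0] by simp

lemma localized_ints_1 [simp]: "1 \<in> localized_ints l"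
  using localized_ints_of_int[of 1] by simp

lemma localized_ints_add:
  assumes "x \<in> localized_ints l" "y \<in> localized_ints l"
  shows "x + y \<in> localized_ints l"
proof -
  obtain a d where x: "coprime d (int l)" "d \<noteq> 0" "x = of_int a / of_int d"
    using assms(1) by (rule localized_ints_E)
  obtain b e where y: "coprime e (int l)" "e \<noteq> 0" "y = of_int b / of_int e"
    using assms(2) by (rule localized_ints_E)
  have "x + y = of_int (a * e + b * d) / of_int (d * e)"
    using x y by (simp add: field_simps)
  then show ?thesis
    using x y by (metis localized_ints_I coprime_mult_left_iff)
qed

lemma localized_ints_mult:
  assumes "x \<in> localized_ints l" "y \<in> localized_ints l"
  shows "x * y \<in> localized_ints l"
proof -
  obtain a d where x: "coprime d (int l)" "x = of_int a / of_int d"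
    using assms(1) by (rule localized_ints_E)
  obtain b e where y: "coprime e (int l)" "y = of_int b / of_int e"
    using assms(2) by (rule localized_ints_E)
  have "x * y = of_int (a * b) / of_int (d * e)"
    using x y by simp
  then show ?thesis
    using x y by (metis localized_ints_I coprime_mult_left_iff)
qed

lemma localized_ints_divide:
  assumes "x \<in> localized_ints l" "coprime d l"
  shows "x / of_nat d \<in> localized_ints l"
proof -
  have "1 / of_int (int d) \<in> localized_ints l"
    using localized_ints_I[of "int d" 1] assms(2) by simp
  with assms(1) have "x * (1 / of_int (int d)) \<in> localized_ints l"
    by (rule localized_ints_mult)
  then show ?thesis by simp
qed

lemma localized_ints_sum:
  "(\<And>i. i \<in> A \<Longrightarrow> f i \<in> localized_ints l) \<Longrightarrow> sum f A \<in> localized_ints l"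
  by (induction A rule: infinite_finite_induct) (auto intro: localized_ints_add)

text \<open>Translates back to the form in which the theorem is stated: the denominators on both
  sides are cleared, and the one from the localization is coprime to l^e.\<close>

lemma dvd_numerator_if_localized:
  assumes "x / of_nat l ^ e \<in> localized_ints l"
  shows "int (l ^ e) dvd fst (quotient_of x)"
proof -
  obtain a d where ad: "coprime d (int l)" "d \<noteq> 0" "x / of_nat l ^ e = of_int a / of_int d"
    using assms by (rule localized_ints_E)
  obtain p q where pq: "quotient_of x = (p, q)" by force
  have q: "q > 0" using quotient_of_denom_pos[OF pq] .
  have "of_int p / of_int q / (of_nat l ^ e :: rat) = of_int a / of_int d"
    using ad(3) quotient_of_div[OF pq] by simp
  then have "of_int (p * d) = (of_int (q * a * int l ^ e) :: rat)"
    using ad(2) q prime_gt_0_nat[OF prime_l] by (simp add: field_simps)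
  then have "p * d = q * a * int l ^ e"
    by (simp only: of_int_eq_iff)
  then have "int l ^ e dvd p * d" by simp
  moreover have "coprime (int l ^ e) d"
    using ad(1) by (simp add: coprime_commute)
  ultimately show ?thesis
    using pq by (simp add: coprime_dvd_mult_left_iff)
qed

text \<open>Clearing denominators with b^i and i! leaves the integer product \<open>B\<close>, so
  only the power of \<open>l\<close> in i! could spoil integrality. It divides \<open>B\<close>
  because integer binomial coefficients are integers.\<close>

lemma gbinomial_localized:
  fixes c :: int and b :: nat
  assumes "coprime b l"
  shows "(of_int c / of_nat b) gchoose i \<in> localized_ints l"
proof -
  \<comment> \<open>Modulo the \<open>l\<close>-part \<open>l ^ v\<close> of \<open>i!\<close>, \<open>c / b\<close> may be replaced by an integer \<open>z * c\<close>.\<close>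
  define v where "v = multiplicity l (fact i)"
  obtain w where w: "fact i = l ^ v * w" "coprime w l"
    using multiplicity_decompose'[of "fact i" l] prime_l
    unfolding v_def by (metis coprime_commute fact_nonzero not_prime_unit prime_imp_coprime)
  define B where "B = (\<Prod>j = 0..<i. c - int j * int b)"
  have "coprime (int b) (int (l ^ v))"
    using assms by simp
  then obtain z where z: "[int b * z = 1] (mod int (l ^ v))"
    using cong_solve_coprime_int by blast
  have "[(\<Prod>j = 0..<i. z * (c - int j * int b)) = (\<Prod>j = 0..<i. z * c - int j)] (mod int (l ^ v))"
  proof (rule cong_prod)
    fix j
    have "[z * c - int j * (int b * z) = z * c - int j * 1] (mod int (l ^ v))"
      by (intro cong_diff cong_refl cong_mult z)
    then show "[z * (c - int j * int b) = z * c - int j] (mod int (l ^ v))"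
      by (simp add: algebra_simps)
  qed
  moreover have "int (l ^ v) dvd (\<Prod>j = 0..<i. z * c - int j)"
  proof -
    have "(fact i :: int) dvd (\<Prod>j = 0..<i. z * c - int j)"
      by (rule dvdI[OF gbinomial_int_mult_fact[symmetric]])
    moreover have "int (l ^ v) dvd fact i"
      using w(1) by (metis of_nat_fact of_nat_mult dvd_triv_left)
    ultimately show ?thesis by (rule dvd_trans[rotated])
  qed
  ultimately have "int (l ^ v) dvd (\<Prod>j = 0..<i. z * (c - int j * int b))"
    by (simp add: cong_dvd_iff)
  then have "int (l ^ v) dvd z ^ i * B"
    by (simp add: B_def prod.distrib)
  \<comment> \<open>As an inverse of \<open>b\<close>, \<open>z\<close> is a unit modulo l^v, so z^i
    can be cancelled.\<close>
  moreover have "coprime (int (l ^ v)) (z ^ i)"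
  proof -
    have "coprime (int (l ^ v)) z"
      using z by (metis coprime_iff_invertible_int coprime_commute mult.commute)
    then show ?thesis by simp
  qed
  ultimately obtain B' where B': "B = int (l ^ v) * B'"
    by (auto simp: coprime_dvd_mult_right_iff)
  have b0: "b \<noteq> 0"
    using assms prime_l by (intro notI) auto
  have "of_int B = (of_nat b ^ i * (\<Prod>j = 0..<i. of_int c / of_nat b - of_nat j) :: rat)"
  proof -
    have "of_int B = (\<Prod>j = 0..<i. of_nat b * (of_int c / of_nat b - of_nat j) :: rat)"
      using b0 by (simp add: B_def algebra_simps)
    then show ?thesis by (simp only: prod.distrib) simp
  qed
  also have "\<dots> = of_nat b ^ i * (fact i * ((of_int c / of_nat b) gchoose i))"
    by (simp only: gbinomial_mult_fact)
  finally have "of_int B = (of_nat b ^ i * (fact i * ((of_int c / of_nat b) gchoose i)) :: rat)" .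
  moreover have "(fact i :: rat) = of_nat l ^ v * of_nat w"
    using arg_cong[OF w(1), of "of_nat :: nat \<Rightarrow> rat"] by simp
  moreover have "w \<noteq> 0"
    using w(1) by (intro notI) auto
  moreover have "l \<noteq> 0"
    using prime_l by (intro notI) auto
  ultimately have "(of_int c / of_nat b :: rat) gchoose i = of_int B' / of_nat (b ^ i * w)"
    using b0 B' by (simp add: field_simps)
  also have "\<dots> \<in> localized_ints l"
    using assms w by (intro localized_ints_divide) auto
  finally show ?thesis .
qed

section \<open>Power series over the localization\<close>

lemma localized_fps_mult:
  assumes "f \<in> localized_fps l" "g \<in> localized_fps l"
  shows "f * g \<in> localized_fps l"
  using assms
  by (auto simp: localized_fps_def fps_mult_nth intro!: localized_ints_sum localized_ints_mult)

lemma localized_fps_add: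
  "f \<in> localized_fps l \<Longrightarrow> g \<in> localized_fps l \<Longrightarrow> f + g \<in> localized_fps l"
  by (auto simp: localized_fps_def intro: localized_ints_add)

lemma localized_fps_1: "1 \<in> localized_fps l"
  by (simp add: localized_fps_def)

lemma localized_fps_X_power: "fps_X ^ j \<in> localized_fps l"
  by (simp add: localized_fps_def fps_X_power_nth)

lemma localized_fps_const: "x \<in> localized_ints l \<Longrightarrow> fps_const x \<in> localized_fps l"
  by (simp add: localized_fps_def)

lemma localized_fps_uminus: "f \<in> localized_fps l \<Longrightarrow> - f \<in> localized_fps l"
  using localized_fps_mult[OF localized_fps_const[OF localized_ints_of_int[of "-1"]], of f]
  by (simp flip: fps_const_neg)

lemma localized_fps_power: "f \<in> localized_fps l \<Longrightarrow> f ^ i \<in> localized_fps l"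
  by (induction i) (auto intro: localized_fps_mult localized_fps_1)

lemma localized_fps_prod:
  "(\<And>i. i \<in> A \<Longrightarrow> f i \<in> localized_fps l) \<Longrightarrow> prod f A \<in> localized_fps l"
  by (induction A rule: infinite_finite_induct) (auto intro: localized_fps_mult localized_fps_1)

lemma localized_fps_compose:
  assumes "f \<in> localized_fps l" "g \<in> localized_fps l"
  shows "f oo g \<in> localized_fps l"
  using assms(1) localized_fps_power[OF assms(2)]
  by (auto simp: localized_fps_def fps_compose_nth intro!: localized_ints_sum localized_ints_mult)

lemma euler_factor_localized:
  assumes "coprime b l"
  shows "euler_factor (of_int c / of_nat b) j \<in> localized_fps l"
  unfolding euler_factor_def
  using gbinomial_localized[OF assms]
  by (intro localized_fps_compose localized_fps_uminus localized_fps_X_power)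
     (simp add: localized_fps_def)

end

section \<open>Partial products of \<open>(\<Prod>(1 - q^j))^t\<close>\<close>

lemma euler_factor_add:
  "j > 0 \<Longrightarrow> euler_factor (t + u) j = euler_factor t j * euler_factor u j"
  by (simp add: euler_factor_def fps_binomial_add_mult fps_compose_mult_distrib)

lemma euler_factor_1: "j > 0 \<Longrightarrow> euler_factor 1 j = 1 - fps_X ^ j"
proof -
  assume "j > 0"
  have "fps_binomial (1::rat) = 1 + fps_X"
    using fps_binomial_of_nat[of 1, where 'a = rat] by simp
  with \<open>j > 0\<close> show ?thesis
    by (simp add: euler_factor_def fps_compose_add_distrib)
qed

text \<open>The inverse of 1 - q^j is written as the factor with exponent -1, so that the
  integrality result for factors covers the logarithmic derivative too.\<close>

lemma fps_deriv_euler_factor: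
  assumes "j > 0"
  shows "fps_deriv (euler_factor t j) =
    fps_const t * euler_factor t j * (euler_factor (-1) j * - fps_deriv (fps_X ^ j))"
proof -
  have "fps_deriv (fps_binomial t) = fps_const t * (fps_binomial t * fps_binomial (-1))"
    by (simp add: fps_binomial_deriv fps_divide_unit fps_binomial_minus_one)
  then show ?thesis
    using assms
    by (simp add: euler_factor_def fps_compose_deriv fps_compose_mult_distrib mult_ac)
qed

text \<open>Logarithmic derivatives add over the factors. The exponent \<open>t\<close> comes out as
  a scalar and the cofactor stays integral at \<open>l\<close>, so any power of \<open>l\<close> in
  \<open>t\<close> survives.\<close>

lemma fps_deriv_euler_prod:
  assumes "prime l"
  shows "\<exists>A \<in> localized_fps l. fps_deriv (\<Prod>j\<le>n. euler_factor t (Suc j)) =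
    fps_const t * (\<Prod>j\<le>n. euler_factor t (Suc j)) * A"
proof -
  have step: "euler_factor (-1) (Suc j) * - fps_deriv (fps_X ^ Suc j) \<in> localized_fps l" for j
  proof -
    have "euler_factor (of_int (-1) / of_nat 1) (Suc j) \<in> localized_fps l"
      by (intro euler_factor_localized assms) simp
    moreover have "fps_const (of_int (int (Suc j))) * fps_X ^ j \<in> localized_fps l"
      by (intro localized_fps_mult localized_fps_const localized_fps_X_power
          localized_ints_of_int assms)
    ultimately show ?thesis
      using assms
      by (intro localized_fps_mult localized_fps_uminus)
         (simp_all add: fps_deriv_power fps_const_add[symmetric] del: fps_const_add power_Suc)
  qed
  show ?thesis
  proof (induction n)
    case 0
    show ?case
      using fps_deriv_euler_factor[of "Suc 0" t]
      by (intro bexI[OF _ step[of 0]]) simp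
  next
    case (Suc n)
    then obtain A where "A \<in> localized_fps l" "fps_deriv (\<Prod>j\<le>n. euler_factor t (Suc j)) =
        fps_const t * (\<Prod>j\<le>n. euler_factor t (Suc j)) * A" by blast
    then show ?case
      by (intro bexI[of _ "A + euler_factor (-1) (Suc (Suc n)) * - fps_deriv (fps_X ^ Suc (Suc n))"]
          localized_fps_add step assms)
        (simp_all add: fps_deriv_euler_factor algebra_simps del: power_Suc)
  qed
qed

text \<open>Compare coefficients of q^(m-1) in G' = u G A: \<open>u\<close> supplies l^k, and its
  denominator \<open>b\<close> is a unit at \<open>l\<close>.\<close>

lemma euler_prod_coeff_localized:
  fixes b k l m :: nat
  assumes "prime l" "coprime b l"
  defines "u \<equiv> - (of_nat l ^ k) / of_nat b"
  shows "of_nat m * fps_nth (\<Prod>j\<le>n. euler_factor u (Suc j)) m / of_nat l ^ k \<in> localized_ints l"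
proof (cases m)
  case 0
  then show ?thesis using assms by simp
next
  case (Suc m')
  define G where "G = (\<Prod>j\<le>n. euler_factor u (Suc j))"
  obtain A where A: "A \<in> localized_fps l" "fps_deriv G = fps_const u * G * A"
    using fps_deriv_euler_prod[OF assms(1)] unfolding G_def by blast
  have u: "u = of_int (- (int l ^ k)) / of_nat b"
    by (simp add: u_def)
  have "G \<in> localized_fps l"
    unfolding G_def u using assms by (intro localized_fps_prod euler_factor_localized)
  then have "G * A \<in> localized_fps l"
    using A assms by (intro localized_fps_mult)
  then have *: "of_int (-1) * fps_nth (G * A) m' / of_nat b \<in> localized_ints l"
    using assms by (intro localized_ints_divide localized_ints_mult localized_ints_of_int)
       (auto simp: localized_fps_def)
  have "of_nat m * fps_nth G m = u * fps_nth (G * A) m'"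
    using arg_cong[OF A(2), of "\<lambda>f. fps_nth f m'"] Suc by (simp add: mult.assoc)
  then have "of_nat m * fps_nth G m / of_nat l ^ k = of_int (-1) * fps_nth (G * A) m' / of_nat b"
    using prime_gt_0_nat[OF assms(1)] by (simp add: u_def)
  with * show ?thesis by (simp add: G_def)
qed

text \<open>Coefficients of partial products stabilize, so everything can be done with finite
  products. The bound \<open>n \<ge> m\<close> keeps the index in the range where the finite
  pentagonal identity applies.\<close>

lemma frac_partition_eq_partial_prod:
  obtains n where "n \<ge> m" "frac_partition t m = fps_nth (\<Prod>j\<le>n. euler_factor t (Suc j)) m"
proof -
  have "eventually (\<lambda>n. fps_nth (\<Prod>j\<le>n. euler_factor t (Suc j)) m = fps_nth (euler_power t) m)
      sequentially"
    using has_prod_imp_tendsto[OF euler_power_has_prod[of t]] unfolding tendsto_fps_iff by blast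
  then have "eventually (\<lambda>n. n \<ge> m \<and> fps_nth (\<Prod>j\<le>n. euler_factor t (Suc j)) m =
      fps_nth (euler_power t) m) sequentially"
    using eventually_ge_at_top by (rule eventually_conj[rotated])
  then show thesis
    using that by (auto simp: eventually_sequentially frac_partition_def)
qed

section \<open>Pentagonal exponents\<close>

text \<open>Shanks' finite form of Euler's pentagonal number theorem. The two exponents are
  k(3k-1)/2 and k(3k+1)/2, split off a triangular number so that the halving is visibly
  exact.\<close>

lemma shanks_identity:
  fixes q :: "'a :: comm_ring_1"
  shows "(\<Sum>k\<le>n. (-1) ^ k * (\<Prod>j=Suc k..n. 1 - q ^ j) * q ^ (k * n + k * (k + 1) div 2)) =
    1 + (\<Sum>k=1..n. (-1) ^ k * (q ^ (k * (k - 1) + k * (k + 1) div 2) + q ^ (k * k + k * (k + 1) div 2)))"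
proof (induction n)
  case 0
  show ?case by simp
next
  case (Suc n)
  define T where "T k = k * (k + 1) div 2" for k :: nat
  have T_Suc: "T (Suc k) = T k + Suc k" for k
    by (simp add: T_def)
  define S where "S n k = (-1) ^ k * (\<Prod>j=Suc k..n. 1 - q ^ j) * q ^ (k * n + T k)" for n k
  \<comment> \<open>The telescoping term: \<open>S n k\<close> with the extra factor 1 - q^k. It
    vanishes at 0, and at \<open>Suc n\<close> its product is empty, leaving the first new
    pentagonal term; the second is \<open>S (Suc n) (Suc n)\<close>.\<close>
  define U where "U k = (-1) ^ k * (\<Prod>j=k..n. 1 - q ^ j) * q ^ (k * n + T k)" for k
  \<comment> \<open>From \<open>(1 - q^(n+1)) q^k - 1 = -(1 - q^k) - q^(n+1+k)\<close>; the right-hand side telescopes.\<close>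
  have "S (Suc n) k = S n k + (U (Suc k) - U k)" if "k \<le> n" for k
  proof -
    define Q where "Q = (-1) ^ k * (\<Prod>j=Suc k..n. 1 - q ^ j) * q ^ (k * n + T k)"
    have "S (Suc n) k = Q * ((1 - q ^ Suc n) * q ^ k)"
      using that by (simp add: S_def Q_def power_add algebra_simps)
    moreover have "U k = Q * (1 - q ^ k)"
      using that by (simp add: U_def Q_def prod.atLeast_Suc_atMost mult_ac)
    moreover have "U (Suc k) = - Q * q ^ (Suc n + k)"
      by (simp add: U_def Q_def T_Suc power_add mult_ac)
    moreover have "S n k = Q" by (simp add: S_def Q_def)
    ultimately show ?thesis
      by (simp add: algebra_simps power_add)
  qed
  then have "(\<Sum>k\<le>Suc n. S (Suc n) k) =
      (\<Sum>k\<le>n. S n k) + (\<Sum>k\<le>n. U (Suc k) - U k) + S (Suc n) (Suc n)"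
    by (simp add: sum.distrib)
  also have "(\<Sum>k\<le>n. U (Suc k) - U k) = U (Suc n) - U 0"
    using sum_lessThan_telescope[of U "Suc n"] by (simp only: lessThan_Suc_atMost)
  also have "U 0 = 0"
    by (simp add: U_def prod.atLeast_Suc_atMost)
  also have "U (Suc n) = (-1) ^ Suc n * q ^ (Suc n * (Suc n - 1) + T (Suc n))"
    by (simp add: U_def)
  also have "S (Suc n) (Suc n) = (-1) ^ Suc n * q ^ (Suc n * Suc n + T (Suc n))"
    by (simp add: S_def)
  finally show ?case
    using Suc by (simp add: S_def T_def distrib_left add.assoc)
qed

text \<open>Completing the square gives the roots 6k - 1 and 6k + 1.\<close>

lemma pentagonal_square:
  assumes "k > 0"
  shows "\<exists>x::int. 24 * int (k * (k - 1) + k * (k + 1) div 2) + 1 = x\<^sup>2"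
    and "\<exists>x::int. 24 * int (k * k + k * (k + 1) div 2) + 1 = x\<^sup>2"
proof -
  define T where "T = k * (k + 1) div 2"
  have "2 * T = k * (k + 1)"
    by (simp add: T_def)
  then have T: "2 * int T = int k * (int k + 1)"
    by (metis of_nat_mult of_nat_numeral of_nat_add of_nat_1)
  have "int (k * (k - 1)) = int k * (int k - 1)"
    using assms by (cases k) (simp_all add: algebra_simps)
  then have "24 * int (k * (k - 1) + T) + 1 = (6 * int k - 1)\<^sup>2"
    using T by (simp only: of_nat_add) (simp add: algebra_simps power2_eq_square)
  then show "\<exists>x::int. 24 * int (k * (k - 1) + k * (k + 1) div 2) + 1 = x\<^sup>2"
    unfolding T_def ..
  have "24 * int (k * k + T) + 1 = (6 * int k + 1)\<^sup>2"
    using T by (simp add: algebra_simps power2_eq_square)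
  then show "\<exists>x::int. 24 * int (k * k + k * (k + 1) div 2) + 1 = x\<^sup>2"
    unfolding T_def ..
qed

text \<open>Put q = \<open>fps_X\<close> in Shanks' identity. On the left the terms with k > 0 start
  beyond degree \<open>n\<close>, so up to there the product itself equals the right-hand side,
  whose exponents are pentagonal.\<close>

lemma euler_prod_support:
  fixes i n :: nat
  assumes "i \<le> n" "fps_nth (\<Prod>j=1..n. 1 - fps_X ^ j :: 'a :: comm_ring_1 fps) i \<noteq> 0"
  shows "\<exists>x::int. 24 * int i + 1 = x\<^sup>2"
proof (rule ccontr)
  assume nsq: "\<not> ?thesis"
  let ?X = "fps_X :: 'a fps"
  have sgn: "fps_nth ((-1) ^ k * f) m = (-1) ^ k * fps_nth f m" for f :: "'a fps" and k m
    by (induction k) (simp_all add: mult.assoc)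
  let ?L = "\<lambda>k. (-1) ^ k * (\<Prod>j=Suc k..n. 1 - ?X ^ j) * ?X ^ (k * n + k * (k + 1) div 2)"
  have "fps_nth (?L k) i = 0" if "k > 0" for k
  proof -
    have "n < k * n + k * (k + 1) div 2"
    proof -
      have "k * (k + 1) div 2 > 0" using that by (cases k) auto
      moreover have "n \<le> k * n" using that by simp
      ultimately show ?thesis by linarith
    qed
    then show ?thesis
      using assms(1) by (simp add: fps_X_power_mult_right_nth)
  qed
  then have "fps_nth (\<Sum>k\<le>n. ?L k) i = fps_nth (?L 0) i"
    by (subst sum.remove[of _ 0]) (auto simp: fps_sum_nth intro!: sum.neutral)
  then have "fps_nth (\<Sum>k\<le>n. ?L k) i \<noteq> 0"
    using assms(2) by simp
  moreover have "fps_nth (1 + (\<Sum>k=1..n. (-1) ^ k * (?X ^ (k * (k - 1) + k * (k + 1) div 2)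
      + ?X ^ (k * k + k * (k + 1) div 2)))) i = 0"
  proof -
    have "i \<noteq> 0"
    proof
      assume "i = 0"
      then have "24 * int i + 1 = 1\<^sup>2" by simp
      with nsq show False by blast
    qed
    moreover have "fps_nth ((-1) ^ k * (?X ^ (k * (k - 1) + k * (k + 1) div 2)
        + ?X ^ (k * k + k * (k + 1) div 2))) i = 0" if "k > 0" for k
      using nsq pentagonal_square[OF that] unfolding sgn fps_add_nth fps_X_power_nth
      by (auto simp del: of_nat_add of_nat_mult)
    ultimately show ?thesis
      by (simp add: fps_sum_nth del: One_nat_def)
  qed
  ultimately show False
    using shanks_identity[where q = ?X and n = n] by metis
qed

section \<open>The congruence\<close>

text \<open>Squares have even valuation: divisibility of x^2 by l^(2s-1) improves to l^(2s), and
  then \<open>l\<close> would have to divide \<open>y\<close>.\<close>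

lemma odd_prime_power_square_not_cong:
  fixes l s :: nat and x y z :: int
  assumes "prime l" "s \<ge> 1" "\<not> int l dvd y"
  shows "\<not> int l ^ (2 * s) dvd z * int l ^ (2 * s) + y * int l ^ (2 * s - 1) - x\<^sup>2"
proof
  assume dvd: "int l ^ (2 * s) dvd z * int l ^ (2 * s) + y * int l ^ (2 * s - 1) - x\<^sup>2"
  have p: "prime (int l)" using assms by simp
  have pow: "int l ^ (2 * s) = int l ^ (2 * s - 1) * int l"
    using assms(2) by (metis One_nat_def Suc_le_D Suc_pred mult.commute mult_2 add_Suc
        power_Suc zero_less_Suc)
  have dvd': "int l ^ (2 * s) dvd y * int l ^ (2 * s - 1) - x\<^sup>2"
    using dvd by (metis add_diff_eq dvd_add_right_iff dvd_triv_right)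
  then have "int l ^ (2 * s - 1) dvd y * int l ^ (2 * s - 1) - x\<^sup>2"
    unfolding pow by (rule dvd_mult_left)
  then have "int l ^ (2 * s - 1) dvd x\<^sup>2"
    by (metis dvd_diff_right_iff dvd_triv_right)
  have "int l ^ s dvd x"
  proof (cases "x = 0")
    case False
    then have "2 * s - 1 \<le> 2 * multiplicity (int l) x"
      using \<open>int l ^ (2 * s - 1) dvd x\<^sup>2\<close> p
      by (metis power_dvd_iff_le_multiplicity prime_elem_multiplicity_power_distrib
          prime_imp_prime_elem zero_eq_power2 not_prime_unit)
    then have "s \<le> multiplicity (int l) x" by linarith
    then show ?thesis by (rule multiplicity_dvd')
  qed simp
  then have "int l ^ (2 * s) dvd x\<^sup>2"
    by (metis dvd_power_same mult.commute power_mult)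
  with dvd' have "int l ^ (2 * s) dvd y * int l ^ (2 * s - 1)"
    by (metis diff_add_cancel dvd_add)
  then have "int l dvd y"
    unfolding pow using assms(1) by (simp add: mult.commute[of y] prime_gt_0_nat)
  with assms(3) show False by contradiction
qed

theorem theorem1p5:
  fixes l k s b n r :: nat
  assumes "prime l" and "l \<ge> 5"
    and "k > 1" and "s \<ge> 1" and "s \<le> k div 2"
    and "b > 0" and "coprime l b"
    and "r < l" and "r \<noteq> l div 24"
  shows "int (l ^ (k - 2 * s + 1)) dvd
    fst (quotient_of
      (frac_partition (- ((of_nat l ^ k - of_nat b) / of_nat b))
        (l ^ (2 * s) * n + l ^ (2 * s - 1) * r
          + ((l - 24 * (l div 24)) * l ^ (2 * s - 1) - 1) div 24)))"
proof -
  define N where "N = l ^ (2 * s) * n + l ^ (2 * s - 1) * r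
          + ((l - 24 * (l div 24)) * l ^ (2 * s - 1) - 1) div 24"
  define t :: rat where "t = - ((of_nat l ^ k - of_nat b) / of_nat b)"
  define u :: rat where "u = - (of_nat l ^ k) / of_nat b"
  define e where "e = k - 2 * s + 1"
  have t: "t = 1 + u"
    using assms(6) by (simp add: t_def u_def field_simps)
  obtain M where M: "M \<ge> N" "frac_partition t N = fps_nth (\<Prod>j\<le>M. euler_factor t (Suc j)) N"
    by (rule frac_partition_eq_partial_prod)
  define G where "G = (\<Prod>j\<le>M. euler_factor u (Suc j))"
  \<comment> \<open>The upper limit is \<open>Suc M\<close> because the factors of the partial
    product are indexed by \<open>Suc j\<close>.\<close>
  define E :: "rat fps" where "E = (\<Prod>j=1..Suc M. 1 - fps_X ^ j)"
  have "(\<Prod>j\<le>M. euler_factor 1 (Suc j)) = E"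
    unfolding E_def
    by (simp add: euler_factor_1 prod.shift_bounds_cl_Suc_ivl atMost_atLeast0 del: power_Suc prod.cl_ivl_Suc)
  then have "(\<Prod>j\<le>M. euler_factor t (Suc j)) = E * G"
    by (simp add: t euler_factor_add prod.distrib G_def)
  then have prod: "frac_partition t N = (\<Sum>i=0..N. fps_nth E i * fps_nth G (N - i))"
    using M(2) by (simp only: fps_mult_nth)
  \<comment> \<open>The offset contributes l * l^(2s-1) = l^(2s), which turns 24n into 24n + 1; its
    remaining part shifts \<open>r\<close> by \<open>l div 24\<close>.\<close>
  have N: "24 * int N + 1 = (24 * int n + 1) * int l ^ (2 * s)
      + 24 * (int r - int (l div 24)) * int l ^ (2 * s - 1)"
  proof -
    define c where "c = ((l - 24 * (l div 24)) * l ^ (2 * s - 1) - 1) div 24"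
    have "24 * int c + 1 = (int l - 24 * int (l div 24)) * int l ^ (2 * s - 1)"
      using arg_cong[OF progression_offset_exact[OF assms(1,2,4)], of int]
      by (simp add: c_def of_nat_diff)
    moreover have "int l ^ (2 * s) = int l ^ (2 * s - 1) * int l"
      using assms(4) by (cases s) simp_all
    ultimately show ?thesis
      unfolding N_def c_def[symmetric] by (simp add: algebra_simps)
  qed
  \<comment> \<open>Since \<open>l \<ge> 5\<close> is coprime to 24, it suffices that
    \<open>r\<close> and \<open>l div 24\<close> are distinct and both lie in [0, l).\<close>
  have ndvd: "\<not> int l dvd 24 * (int r - int (l div 24))"
  proof
    assume "int l dvd 24 * (int r - int (l div 24))"
    moreover have "coprime (int l) 24"
    proof -
      have "coprime l 2" "coprime l 3"
        using assms(1,2) primes_coprime[of l 2] primes_coprime[of l 3] by auto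
      then have "coprime l (2 ^ 3 * 3)"
        by (simp only: coprime_mult_right_iff coprime_power_right_iff) simp
      then have "coprime (int l) (int 24)"
        by (subst coprime_int_iff) simp
      then show ?thesis by simp
    qed
    ultimately have "int l dvd int r - int (l div 24)"
      by (simp only: coprime_dvd_mult_right_iff)
    moreover have "\<bar>int r - int (l div 24)\<bar> < int l"
      using assms(2,8) by linarith
    ultimately show False
      using assms(9) dvd_imp_le_int[of "int r - int (l div 24)" "int l"] by auto
  qed
  \<comment> \<open>The convolution is handled term by term: either the coefficient of
    \<open>E\<close> vanishes, or \<open>N - i\<close> has small valuation at
    \<open>l\<close>.\<close>
  have summand: "fps_nth E i * fps_nth G (N - i) / of_nat l ^ e \<in> localized_ints l" if "i \<le> N" for i
  proof (cases "fps_nth E i = 0")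
    case True
    then show ?thesis using assms(1) by simp
  next
    case False
    moreover have "i \<le> Suc M"
      using that M(1) by simp
    ultimately obtain x :: int where x: "24 * int i + 1 = x\<^sup>2"
      using euler_prod_support unfolding E_def by blast
    have "\<not> l ^ (2 * s) dvd N - i"
    proof
      assume "l ^ (2 * s) dvd N - i"
      then have "int l ^ (2 * s) dvd int (N - i)"
        by (metis of_nat_dvd_iff of_nat_power)
      then have "int l ^ (2 * s) dvd 24 * int (N - i)"
        by (rule dvd_mult)
      also have "24 * int (N - i) = (24 * int N + 1) - x\<^sup>2"
        using that x by (simp add: of_nat_diff)
      finally show False
        using odd_prime_power_square_not_cong[OF assms(1,4) ndvd] unfolding N by blast
    qed
    define v where "v = multiplicity l (N - i)"
    have "N - i \<noteq> 0"
      using \<open>\<not> l ^ (2 * s) dvd N - i\<close> by (metis dvd_0_right)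
    then obtain w where w: "N - i = l ^ v * w" "coprime w l"
      using multiplicity_decompose'[of "N - i" l] assms(1)
      unfolding v_def by (metis coprime_commute not_prime_unit prime_imp_coprime)
    have "v < 2 * s"
      using \<open>\<not> l ^ (2 * s) dvd N - i\<close> unfolding v_def
      by (meson multiplicity_dvd' not_le)
    \<comment> \<open>The valuation is at most 2s - 1 = k - e, so the exponent k - v - e is an exact
      difference.\<close>
    then have ve: "k = v + e + (k - v - e)"
      using assms(4,5) by (simp add: e_def)
    have l0: "l \<noteq> 0" using assms(2) by simp
    have w0: "w \<noteq> 0" using w(1) \<open>N - i \<noteq> 0\<close> by (intro notI) auto
    have "of_nat (N - i) * fps_nth G (N - i) / of_nat l ^ k \<in> localized_ints l"
      unfolding G_def u_def using assms
      by (intro euler_prod_coeff_localized) (auto simp: coprime_commute)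
    \<comment> \<open>Dividing by the unit \<open>w\<close> and multiplying by the surplus power of
      \<open>l\<close> removes the factor \<open>N - i\<close> and lowers l^k to l^e in the
      denominator.\<close>
    then have "of_int (int l ^ (k - v - e)) * (of_nat (N - i) * fps_nth G (N - i) / of_nat l ^ k)
        / of_nat w \<in> localized_ints l"
      using assms(1) w(2) by (intro localized_ints_divide localized_ints_mult localized_ints_of_int)
    also have "of_int (int l ^ (k - v - e)) * (of_nat (N - i) * fps_nth G (N - i) / of_nat l ^ k)
        / of_nat w = fps_nth G (N - i) / of_nat l ^ e"
    proof -
      have "of_nat (N - i) = (of_nat l ^ v * of_nat w :: rat)"
        unfolding w(1) by simp
      moreover have "(of_nat l ^ k :: rat) = of_nat l ^ v * of_nat l ^ e * of_nat l ^ (k - v - e)"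
        by (subst ve) (simp only: power_add)
      ultimately show ?thesis
        using l0 w0 by (simp add: field_simps)
    qed
    finally have G: "fps_nth G (N - i) / of_nat l ^ e \<in> localized_ints l" .
    have "1 - fps_X ^ j \<in> localized_fps l" for j
      using assms(1) localized_fps_add[OF assms(1) localized_fps_1 localized_fps_uminus]
      by (metis add_uminus_conv_diff localized_fps_X_power)
    then have "E \<in> localized_fps l"
      unfolding E_def using assms(1) by (intro localized_fps_prod)
    then have "fps_nth E i * (fps_nth G (N - i) / of_nat l ^ e) \<in> localized_ints l"
      using assms(1) G by (intro localized_ints_mult) (auto simp: localized_fps_def)
    then show ?thesis by simp
  qed
  have "frac_partition t N / of_nat l ^ e \<in> localized_ints l"
    unfolding prod sum_divide_distrib using assms(1) summand by (intro localized_ints_sum) auto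
  then show ?thesis
    unfolding N_def[symmetric] t_def[symmetric] e_def[symmetric]
    by (rule dvd_numerator_if_localized[OF assms(1)])
qed

end
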